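(* There exist a sequence of real numbers $(\delta_k)$ with $\delta_k\to 0$ as $k\to\infty$ and, for all sufficiently large $k$, a Boolean function $f_k\in P_k^{2^{k-1}-1}$ such that every minimal DNF of $f_k$ contains more than $$\frac{5}{3}\cdot 2^k\,(1+\delta_k)$$ literals.
   Context: $P_k^n$ denotes the class of Boolean functions $f:\{0,1\}^n\to\{0,1\}$ of $n$ variables that take the value $0$ at exactly $k$ points. A literal is a variable or its negation; a conjunction is a product of literals; a DNF of $f$ is a disjunction of conjunctions representing $f$. The number of literals (rank) of a DNF is the total number of literal occurrences in it, i.e. the sum over its conjunctions of their numbers of literals. A minimal DNF of $f$ is a DNF of $f$ of minimum rank. *)

theory Defs
  imports Complex_Main "HOL-Library.FuncSet"
begin

definition cube :: "nat \<Rightarrow> bool list set" where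
  "cube n = {x. length x = n}"

text \<open>A Boolean function of \<open>n\<close> variables is an extensional function on the cube, so that
  distinct elements of the class below differ at a point of the cube. The variables are numbered
  \<open>0, \<dots>, n - 1\<close>.\<close>

definition P_class :: "nat \<Rightarrow> nat \<Rightarrow> (bool list \<Rightarrow> bool) set" where
  "P_class k n = {f \<in> cube n \<rightarrow>\<^sub>E UNIV. card {x \<in> cube n. \<not> f x} = k}"

datatype lit = Pos nat | Neg nat

fun lit_var :: "lit \<Rightarrow> nat" where
  "lit_var (Pos i) = i"
| "lit_var (Neg i) = i"

fun lit_eval :: "lit \<Rightarrow> bool list \<Rightarrow> bool" where
  "lit_eval (Pos i) x = x ! i"
| "lit_eval (Neg i) x = (\<not> x ! i)"

text \<open>Conjunctions and DNFs are formal expressions, hence lists: the rank counts occurrences of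
  literals. The empty conjunction is the constant 1, the empty DNF is the constant 0.\<close>

type_synonym conjunction = "lit list"
type_synonym dnf = "conjunction list"

definition conj_eval :: "conjunction \<Rightarrow> bool list \<Rightarrow> bool" where
  "conj_eval C x \<longleftrightarrow> (\<forall>l \<in> set C. lit_eval l x)"

definition dnf_eval :: "dnf \<Rightarrow> bool list \<Rightarrow> bool" where
  "dnf_eval D x \<longleftrightarrow> (\<exists>C \<in> set D. conj_eval C x)"

definition dnf_rank :: "dnf \<Rightarrow> nat" where
  "dnf_rank D = (\<Sum>C\<leftarrow>D. length C)"

definition is_dnf_of :: "nat \<Rightarrow> (bool list \<Rightarrow> bool) \<Rightarrow> dnf \<Rightarrow> bool" where
  "is_dnf_of n f D \<longleftrightarrow>
     (\<forall>C \<in> set D. \<forall>l \<in> set C. lit_var l < n) \<and> (\<forall>x \<in> cube n. f x \<longleftrightarrow> dnf_eval D x)"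

definition minimal_dnf :: "nat \<Rightarrow> (bool list \<Rightarrow> bool) \<Rightarrow> dnf \<Rightarrow> bool" where
  "minimal_dnf n f D \<longleftrightarrow> is_arg_min dnf_rank (is_dnf_of n f) D"

end

theory Submission
  imports Defs
begin

text \<open>Write the zeros of a function as the rows of a 0-1 matrix, and identify each literal with the
  set of rows at which it is true. A conjunction is then a family of subsets of the set of rows,
  and it is an implicant exactly when the family has empty intersection. The function used here has
  as columns, up to complementation, precisely the \<^emph>\<open>balanced\<close> sets, those whose density is between
  \<open>5/12\<close> and \<open>7/12\<close>; the remaining variables vanish on every zero. By Chebyshev's
  inequality all but a fraction \<open>O(1/k)\<close> of the subsets are balanced, so there are
  \<open>2 ^ k * (1 - O(1/k))\<close> relevant literals, and it suffices that a DNF contains on average \<open>5/3\<close>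
  occurrences of each (\<open>five_thirds\<close>). Using all columns would not be enough: the complements of
  singletons allow implicants such as \<open>S\<close>, \<open>(U - S) \<union> {i}\<close>, \<open>U - {i}\<close>, by which
  almost all literals can be paired off at a cost of \<open>3/2\<close> occurrences each.

  The only points that matter are the neighbours of zeros. If \<open>r \<notin> S\<close>, then flipping in row \<open>r\<close>
  the variable of the literal \<open>S\<close> makes \<open>S\<close> true, and the conjunction covering this point contains
  \<open>S\<close>, while all its other members contain \<open>r\<close>. So the occurrences of \<open>S\<close> must together serve all
  rows outside \<open>S\<close>. If \<open>S\<close> occurs only once (a \<^emph>\<open>solo\<close>), then the other members of its conjunction
  are supersets of \<open>U - S\<close>, and there are at least two of them because \<open>U - S\<close> itself, the opposite
  literal, is excluded. Balancedness then has two effects: two solos cannot share a conjunction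
  (\<open>solo_unique\<close>), as a third member would have to contain two disjoint balanced sets; and a
  conjunction with a solo serves a non-solo member at no more than one sixth of the rows
  (\<open>served_beside_solo\<close>), as a balanced set containing \<open>U - S\<close> has few elements in \<open>S\<close>.

  Let a non-solo set occur \<open>p\<close> times in conjunctions with a solo and \<open>q\<close> times elsewhere. Then
  \<open>p + q \<ge> 2\<close>, and \<open>p \<ge> 3\<close> if \<open>q = 0\<close>, whence \<open>3 * (p + q) \<ge> 5 + p\<close>. The sum of the \<open>p\<close> over all
  non-solos is at least twice the number of solos, and these two units, added to the three that
  the single occurrence of a solo contributes, also make five for each solo.\<close>

section \<open>Balanced sets\<close>

text \<open>The constants leave room for the two estimates that need it: two disjoint balanced sets do
  not fit into a third one, since \<open>5 + 5 > 7\<close>, and two pieces of size at most the difference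
  \<open>(7 - 5)/12\<close> do not cover a set of density \<open>5/12\<close>.\<close>

definition balanced :: "'a set \<Rightarrow> 'a set set" where
  "balanced U = {A. A \<subseteq> U \<and> 5 * card U \<le> 12 * card A \<and> 12 * card A \<le> 7 * card U}"

lemma finite_balanced: "finite U \<Longrightarrow> finite (balanced U)"
  by (rule finite_subset[of _ "Pow U"]) (auto simp: balanced_def)

lemma balanced_Diff:
  assumes "finite U" "A \<in> balanced U"
  shows "U - A \<in> balanced U"
proof -
  have "A \<subseteq> U" using assms by (auto simp: balanced_def)
  then have "card (U - A) = card U - card A" "card A \<le> card U"
    using assms(1) by (auto simp: card_Diff_subset finite_subset card_mono)
  then show ?thesis using assms by (auto simp: balanced_def)
qed

lemma sum_Pow_insert:
  fixes h :: "'a set \<Rightarrow> 'b::comm_monoid_add"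
  assumes "finite U" "u \<notin> U"
  shows "(\<Sum>A\<in>Pow (insert u U). h A) = (\<Sum>A\<in>Pow U. h A) + (\<Sum>A\<in>Pow U. h (insert u A))"
proof -
  have "inj_on (insert u) (Pow U)"
    using assms(2) by (auto simp: inj_on_def)
  moreover have "Pow U \<inter> insert u ` Pow U = {}"
    using assms(2) by auto
  ultimately show ?thesis
    using assms(1) by (simp add: Pow_insert sum.union_disjoint sum.reindex)
qed

text \<open>The variance of a sum of independent random signs, one for each element of \<open>U\<close>.\<close>

lemma sum_Pow_discrepancy:
  "finite U \<Longrightarrow> (\<Sum>A\<in>Pow U. (2 * real (card A) - real (card U))\<^sup>2) = real (card U) * 2 ^ card U"
proof (induction U rule: finite_induct)
  case empty
  show ?case by simp
next
  case (insert u U)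
  let ?d = "\<lambda>A. 2 * real (card A) - real (card U)"
  have "(\<Sum>A\<in>Pow (insert u U). (2 * real (card A) - real (card (insert u U)))\<^sup>2)
      = (\<Sum>A\<in>Pow U. (?d A - 1)\<^sup>2) + (\<Sum>A\<in>Pow U. (?d A + 1)\<^sup>2)"
  proof -
    have "card (insert u A) = Suc (card A)" if "A \<in> Pow U" for A
      using that insert.hyps finite_subset[of A U] by (auto intro!: card_insert_disjoint)
    then show ?thesis
      using insert.hyps by (simp add: sum_Pow_insert algebra_simps)
  qed
  also have "\<dots> = (\<Sum>A\<in>Pow U. 2 * (?d A)\<^sup>2 + 2)"
    unfolding sum.distrib[symmetric] by (intro sum.cong) (auto simp: power2_eq_square algebra_simps)
  also have "\<dots> = 2 * (real (card U) * 2 ^ card U) + 2 * 2 ^ card U"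
    using insert by (simp add: sum.distrib sum_distrib_left[symmetric] card_Pow)
  finally show ?case
    using insert.hyps by (simp add: algebra_simps)
qed

text \<open>Chebyshev's inequality: an unbalanced set has discrepancy greater than \<open>card U / 6\<close>.\<close>

lemma card_balanced:
  assumes "finite U" "U \<noteq> {}"
  shows "real (card (balanced U)) \<ge> 2 ^ card U * (1 - 36 / real (card U))"
proof -
  let ?k = "real (card U)" and ?B = "Pow U - balanced U"
  have k: "?k > 0" using assms by (simp add: card_gt_0_iff)
  have sub: "balanced U \<subseteq> Pow U" by (auto simp: balanced_def)
  have "?k\<^sup>2 / 36 * real (card ?B) = (\<Sum>A\<in>?B. ?k\<^sup>2 / 36)" by simp
  also have "\<dots> \<le> (\<Sum>A\<in>?B. (2 * real (card A) - ?k)\<^sup>2)"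
  proof (rule sum_mono)
    fix A assume "A \<in> ?B"
    then have "12 * card A < 5 * card U \<or> 7 * card U < 12 * card A"
      by (auto simp: balanced_def)
    then have "12 * real (card A) < 5 * ?k \<or> 7 * ?k < 12 * real (card A)" by linarith
    then have "\<bar>?k / 6\<bar> \<le> \<bar>2 * real (card A) - ?k\<bar>" by linarith
    then have "(?k / 6)\<^sup>2 \<le> (2 * real (card A) - ?k)\<^sup>2" by (simp only: abs_le_square_iff)
    then show "?k\<^sup>2 / 36 \<le> (2 * real (card A) - ?k)\<^sup>2" by (simp add: power_divide)
  qed
  also have "\<dots> \<le> (\<Sum>A\<in>Pow U. (2 * real (card A) - ?k)\<^sup>2)"
    using assms(1) by (intro sum_mono2) auto
  also have "\<dots> = ?k * 2 ^ card U" by (rule sum_Pow_discrepancy[OF assms(1)])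
  finally have "real (card ?B) \<le> 36 * 2 ^ card U / ?k"
    using k by (simp add: field_simps power2_eq_square)
  moreover have "real (card (balanced U)) + real (card ?B) = 2 ^ card U"
  proof -
    have "card (balanced U) + card ?B = card (Pow U)"
      using card_Int_Diff[of "Pow U" "balanced U"] sub assms(1) by (simp add: Int_absorb1)
    also have "\<dots> = 2 ^ card U" using assms(1) by (rule card_Pow)
    finally have "real (card (balanced U) + card ?B) = real (2 ^ card U)" by (simp only:)
    then show ?thesis by simp
  qed
  ultimately show ?thesis by (simp add: field_simps)
qed

text \<open>Two arbitrary sets can be avoided because, once \<open>r\<close> and all but one further element are
  chosen, at least three choices remain for the last one. With \<open>B\<close> and \<open>B'\<close> complementary, the
  lemma yields two essentially different columns that tell \<open>r\<close> from \<open>r'\<close>, so that rows of the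
  matrix lie at Hamming distance at least two.\<close>

lemma balanced_separating:
  assumes "finite U" "card U \<ge> 7" "r \<in> U" "r' \<in> U" "r \<noteq> r'"
  shows "\<exists>A \<in> balanced U. r \<in> A \<and> r' \<notin> A \<and> A \<noteq> B \<and> A \<noteq> B'"
proof -
  define h where "h = card U div 2"
  have h: "h \<ge> 3" "card U - h \<ge> 3" "5 * card U \<le> 12 * h" "12 * h \<le> 7 * card U"
    using assms(2) by (auto simp: h_def)
  have cX: "card (U - {r, r'}) = card U - 2"
    using assms by (simp add: card_Diff_subset)
  then have "h - 2 \<le> card (U - {r, r'})" using h by linarith
  then obtain W where W: "W \<subseteq> U - {r, r'}" "card W = h - 2" "finite W"
    by (rule obtain_subset_with_card_n)
  define E where "E = U - {r, r'} - W"
  have "card E = card U - h"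
    using W cX h by (simp add: E_def card_Diff_subset)
  then have cE: "card E \<ge> 3" using h by simp
  let ?A = "\<lambda>e. insert e (insert r W)"
  have "inj_on ?A E"
    by (auto simp: inj_on_def E_def insert_eq_iff)
  then have "card (?A ` E) \<ge> 3" using cE by (simp add: card_image)
  moreover have "card {B, B'} \<le> 2" by (simp add: card_insert_if)
  ultimately have "\<not> ?A ` E \<subseteq> {B, B'}"
    using card_mono[of "{B, B'}" "?A ` E"] by fastforce
  then obtain e where e: "e \<in> E" "?A e \<notin> {B, B'}" by blast
  have "card (?A e) = h"
    using e W h by (auto simp: E_def card_insert_if)
  then have "?A e \<in> balanced U"
    using e W h assms(3) by (auto simp: balanced_def E_def)
  then show ?thesis using e W assms(5) by (intro bexI[of _ "?A e"]) (auto simp: E_def)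
qed

section \<open>Counting occurrences\<close>

text \<open>The part of a DNF that the lower bound sees: \<open>U\<close> consists of the rows, and \<open>F j\<close> of the sets
  of rows at which the literals of the conjunction \<open>j\<close> are true. The third property of \<open>F\<close> comes
  from covering the neighbours of the zeros; \<open>U - S \<notin> F j\<close> says that a covering conjunction is
  satisfiable.\<close>

locale serving_family =
  fixes U :: "'a set" and J :: "'j set" and F :: "'j \<Rightarrow> 'a set set"
  assumes finite_U: "finite U" and U_nonempty: "U \<noteq> {}"
    and finite_J: "finite J"
    and F_balanced: "j \<in> J \<Longrightarrow> F j \<subseteq> balanced U"
    and F_empty_Inter: "j \<in> J \<Longrightarrow> r \<in> U \<Longrightarrow> \<exists>A \<in> F j. r \<notin> A"
    and F_serves: "S \<in> balanced U \<Longrightarrow> r \<in> U - S \<Longrightarrow>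
      \<exists>j \<in> J. S \<in> F j \<and> U - S \<notin> F j \<and> (\<forall>T \<in> F j. T \<noteq> S \<longrightarrow> r \<in> T)"
begin

definition occ :: "'a set \<Rightarrow> 'j set" where
  "occ S = {j \<in> J. S \<in> F j}"

definition served :: "'j \<Rightarrow> 'a set \<Rightarrow> 'a set" where
  "served j S = {r \<in> U - S. \<forall>T \<in> F j. T \<noteq> S \<longrightarrow> r \<in> T}"

definition solos :: "'a set set" where
  "solos = {S \<in> balanced U. card (occ S) = 1}"

definition solo_at :: "'j set" where
  "solo_at = {j \<in> J. F j \<inter> solos \<noteq> {}}"

lemma finite_occ [simp]: "finite (occ S)"
  using finite_J by (simp add: occ_def)

lemma finite_F: "j \<in> J \<Longrightarrow> finite (F j)"
  using F_balanced finite_balanced[OF finite_U] by (meson finite_subset)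

lemma card_U_pos: "card U > 0"
  using finite_U U_nonempty by (simp add: card_gt_0_iff)

lemma compl_served:
  assumes "S \<in> balanced U"
  shows "U - S \<subseteq> (\<Union>j \<in> occ S. served j S)"
proof
  fix r assume r: "r \<in> U - S"
  then obtain j where "j \<in> J" "S \<in> F j" "\<forall>T \<in> F j. T \<noteq> S \<longrightarrow> r \<in> T"
    using F_serves[OF assms] by blast
  with r have "j \<in> occ S" "r \<in> served j S" by (simp_all add: occ_def served_def)
  then show "r \<in> (\<Union>j \<in> occ S. served j S)" by blast
qed

lemma balancedD:
  assumes "S \<in> balanced U"
  shows "S \<subseteq> U" "finite S" "5 * card U \<le> 12 * card S" "12 * card S \<le> 7 * card U"
    "card (U - S) = card U - card S" "card S \<le> card U"
proof -
  show sub: "S \<subseteq> U" using assms by (auto simp: balanced_def)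
  then show fin: "finite S" using finite_U finite_subset by blast
  show "card (U - S) = card U - card S" "card S \<le> card U"
    using sub fin finite_U by (auto simp: card_Diff_subset card_mono)
qed (use assms in \<open>auto simp: balanced_def\<close>)

lemma compl_nonempty:
  assumes "S \<in> balanced U"
  shows "U - S \<noteq> {}"
proof -
  have "card (U - S) > 0"
    using balancedD[OF assms] card_U_pos by linarith
  then show ?thesis by (metis card.empty less_irrefl)
qed

lemma solo_superset:
  assumes S: "S \<in> solos" and j: "j \<in> J" "S \<in> F j"
  shows "U - S \<notin> F j" "T \<in> F j \<Longrightarrow> T \<noteq> S \<Longrightarrow> U - S \<subseteq> T"
proof -
  have bal: "S \<in> balanced U" using S by (simp add: solos_def)
  have "card (occ S) = 1" using S by (simp add: solos_def)
  then have only: "i = j" if "i \<in> J" "S \<in> F i" for i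
  proof -
    have "i \<in> occ S" "j \<in> occ S" using that j by (simp_all add: occ_def)
    then show ?thesis using \<open>card (occ S) = 1\<close> by (metis card_1_singletonE singletonD)
  qed
  have *: "U - S \<notin> F j \<and> (\<forall>T \<in> F j. T \<noteq> S \<longrightarrow> r \<in> T)" if "r \<in> U - S" for r
    using F_serves[OF bal that] only by blast
  show "U - S \<notin> F j" using compl_nonempty[OF bal] * by blast
  show "T \<in> F j \<Longrightarrow> T \<noteq> S \<Longrightarrow> U - S \<subseteq> T" using * by blast
qed

lemma solo_partner:
  assumes S: "S \<in> solos" and j: "j \<in> J" "S \<in> F j"
  shows "\<exists>T \<in> F j. T \<noteq> S"
proof (rule ccontr)
  assume "\<not> ?thesis"
  then have "\<forall>r\<in>U. r \<notin> S" using F_empty_Inter[OF j(1)] j(2) by blast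
  moreover have bal: "S \<in> balanced U" using S by (simp add: solos_def)
  ultimately have "S = {}" using balancedD(1)[OF bal] by blast
  then have "card S = 0" by simp
  then show False using balancedD(3)[OF bal] card_U_pos by linarith
qed

text \<open>With only two members \<open>S\<close> and \<open>T\<close>, empty intersection together with \<open>U - S \<subseteq> T\<close> would make
  \<open>T\<close> the opposite literal.\<close>

lemma solo_third:
  assumes S: "S \<in> solos" and j: "j \<in> J" "S \<in> F j" and T: "T \<in> F j" "T \<noteq> S"
  shows "\<exists>T' \<in> F j. T' \<noteq> S \<and> T' \<noteq> T"
proof (rule ccontr)
  assume "\<not> ?thesis"
  then have "\<forall>r\<in>U. r \<notin> S \<or> r \<notin> T" using F_empty_Inter[OF j(1)] by metis
  moreover have "U - S \<subseteq> T" using solo_superset[OF S j] T by blast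
  moreover have "T \<subseteq> U" using F_balanced[OF j(1)] T by (auto simp: balanced_def)
  ultimately have "T = U - S" by blast
  then show False using solo_superset(1)[OF S j] T by simp
qed

text \<open>A further member \<open>T\<close> contains \<open>U - S\<close> and \<open>U - S'\<close>, which are disjoint because \<open>S'\<close> contains
  \<open>U - S\<close>; so \<open>T\<close> would have density at least \<open>10/12\<close>.\<close>

lemma solo_unique:
  assumes j: "j \<in> J" and S: "S \<in> solos" "S \<in> F j" and S': "S' \<in> solos" "S' \<in> F j"
  shows "S = S'"
proof (rule ccontr)
  assume ne: "S \<noteq> S'"
  obtain T where T: "T \<in> F j" "T \<noteq> S" "T \<noteq> S'"
    using solo_third[OF S(1) j S(2) S'(2)] ne by auto
  have sub: "(U - S) \<union> (U - S') \<subseteq> T"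
    using solo_superset(2)[OF S(1) j S(2)] solo_superset(2)[OF S'(1) j S'(2)] T by blast
  have disj: "(U - S) \<inter> (U - S') = {}"
    using solo_superset(2)[OF S(1) j S(2) S'(2)] ne by blast
  have bal: "S \<in> balanced U" "S' \<in> balanced U" "T \<in> balanced U"
    using F_balanced[OF j] S S' T by auto
  have "card (U - S) + card (U - S') \<le> card T"
    using sub disj finite_U balancedD(2)[OF bal(3)]
    by (metis card_Un_disjoint card_mono finite_Diff)
  then show False
    using balancedD[OF bal(1)] balancedD[OF bal(2)] balancedD[OF bal(3)] card_U_pos by linarith
qed

text \<open>The rows served lie in a further member \<open>T'\<close>, but not in \<open>U - S\<close>, which is contained in \<open>T\<close>.
  As \<open>T'\<close> contains \<open>U - S\<close> as well, what is left of it has density at most \<open>7/12 - 5/12\<close>.\<close>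

lemma served_beside_solo:
  assumes S: "S \<in> solos" and j: "j \<in> J" "S \<in> F j" and T: "T \<in> F j" "T \<noteq> S"
  shows "6 * card (served j T) \<le> card U"
proof -
  obtain T' where T': "T' \<in> F j" "T' \<noteq> S" "T' \<noteq> T"
    using solo_third[OF S j T] by blast
  have bal: "S \<in> balanced U" "T' \<in> balanced U" using F_balanced[OF j(1)] j T' by auto
  have "served j T \<subseteq> T' - (U - S)"
    using T' j T by (auto simp: served_def)
  then have "card (served j T) \<le> card (T' - (U - S))"
    using balancedD(2)[OF bal(2)] by (intro card_mono) auto
  also have "\<dots> = card T' - card (U - S)"
    using solo_superset(2)[OF S j T'(1,2)] finite_U by (intro card_Diff_subset) auto
  finally show ?thesis
    using balancedD[OF bal(1)] balancedD[OF bal(2)] by linarith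
qed

text \<open>In terms of \<open>p\<close> and \<open>q\<close>, this is the inequality \<open>3 * (p + q) \<ge> 5 + p\<close>. The only
  combination that has to be excluded, besides \<open>p + q \<le> 1\<close>, is \<open>p = 2\<close>, \<open>q = 0\<close>; there
  at most \<open>2/6\<close> of the rows would be served, less than the density of \<open>U - T\<close>.\<close>

lemma occ_weight:
  assumes T: "T \<in> balanced U - solos"
  shows "2 * card (occ T \<inter> solo_at) + 3 * card (occ T - solo_at) \<ge> 5"
proof -
  have bal: "T \<in> balanced U" using T by simp
  have "occ T \<noteq> {}" using compl_served[OF bal] compl_nonempty[OF bal] by blast
  then have "card (occ T) \<noteq> 0" by simp
  moreover have "card (occ T) \<noteq> 1" using T by (auto simp: solos_def)
  moreover have "card (occ T) = card (occ T \<inter> solo_at) + card (occ T - solo_at)"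
    using card_Int_Diff finite_occ by blast
  moreover have "card (occ T \<inter> solo_at) \<ge> 3" if "occ T - solo_at = {}"
  proof -
    have "card (U - T) \<le> card (\<Union>j \<in> occ T. served j T)"
      by (rule card_mono) (use compl_served[OF bal] finite_U in \<open>auto simp: served_def\<close>)
    also have "\<dots> \<le> (\<Sum>j \<in> occ T. card (served j T))" by (rule card_UN_le) simp
    finally have "6 * card (U - T) \<le> (\<Sum>j \<in> occ T. 6 * card (served j T))"
      by (simp add: sum_distrib_left[symmetric])
    also have "\<dots> \<le> (\<Sum>j \<in> occ T. card U)"
    proof (rule sum_mono)
      fix j assume j: "j \<in> occ T"
      then have "j \<in> solo_at" using that by auto
      then obtain S where S: "S \<in> F j" "S \<in> solos" by (auto simp: solo_at_def)
      with T have "T \<noteq> S" by auto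
      with S j show "6 * card (served j T) \<le> card U"
        by (intro served_beside_solo) (auto simp: occ_def)
    qed
    finally have "6 * card (U - T) \<le> card (occ T) * card U" by simp
    moreover have "6 * card (U - T) > 2 * card U"
      using balancedD[OF bal] card_U_pos by linarith
    ultimately have "2 * card U < card (occ T) * card U" by linarith
    then have "card (occ T) > 2" by simp
    moreover have "occ T \<inter> solo_at = occ T" using that by auto
    ultimately show ?thesis by simp
  qed
  ultimately show ?thesis
    using card_gt_0_iff[of "occ T - solo_at"] finite_occ[of T]
    by (cases "occ T - solo_at = {}") (simp, fastforce)
qed

lemma sum_card_double_count:
  assumes "I \<subseteq> J"
  shows "(\<Sum>j\<in>I. card (F j \<inter> B)) = (\<Sum>T\<in>balanced U \<inter> B. card (occ T \<inter> I))"
proof -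
  have fin: "finite I" using assms finite_J finite_subset by blast
  have "(\<Sum>j\<in>I. card (F j \<inter> B)) = (\<Sum>j\<in>I. \<Sum>T\<in>balanced U \<inter> B. if T \<in> F j then 1 else 0)"
  proof (rule sum.cong)
    fix j assume "j \<in> I"
    then have "F j \<inter> B = {T \<in> balanced U \<inter> B. T \<in> F j}" using F_balanced assms by auto
    then show "card (F j \<inter> B) = (\<Sum>T\<in>balanced U \<inter> B. if T \<in> F j then 1 else 0)"
      using finite_balanced[OF finite_U] by (simp add: sum.If_cases Int_def)
  qed simp
  also have "\<dots> = (\<Sum>T\<in>balanced U \<inter> B. \<Sum>j\<in>I. if T \<in> F j then 1 else 0)"
    by (rule sum.swap)
  also have "\<dots> = (\<Sum>T\<in>balanced U \<inter> B. card (occ T \<inter> I))"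
  proof (rule sum.cong)
    fix T
    have "occ T \<inter> I = {j \<in> I. T \<in> F j}" using assms by (auto simp: occ_def)
    then show "(\<Sum>j\<in>I. if T \<in> F j then 1 else 0) = card (occ T \<inter> I)"
      using fin by (simp add: sum.If_cases Int_def)
  qed simp
  finally show ?thesis .
qed

lemma five_thirds: "5 * card (balanced U) \<le> 3 * (\<Sum>j\<in>J. card (F j))"
proof -
  let ?N = "balanced U - solos"
  have fin: "finite (balanced U)" by (rule finite_balanced[OF finite_U])
  have sub: "solos \<subseteq> balanced U" by (auto simp: solos_def)
  have solo_at: "solo_at \<subseteq> J" by (auto simp: solo_at_def)
  have occ_J: "occ T \<inter> J = occ T" for T by (auto simp: occ_def)
  have solo_count: "card solos = card solo_at"
  proof -
    have "card solos = (\<Sum>S\<in>balanced U \<inter> solos. card (occ S \<inter> solo_at))"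
    proof -
      have "occ S \<inter> solo_at = occ S" if "S \<in> solos" for S
        using that by (auto simp: occ_def solo_at_def)
      then show ?thesis using sub by (simp add: Int_absorb1 solos_def)
    qed
    also have "\<dots> = (\<Sum>j\<in>solo_at. card (F j \<inter> solos))"
      by (rule sum_card_double_count[OF solo_at, symmetric])
    also have "\<dots> = card solo_at"
    proof -
      have "card (F j \<inter> solos) = 1" if "j \<in> solo_at" for j
      proof -
        from that obtain S where "j \<in> J" "S \<in> F j" "S \<in> solos" by (auto simp: solo_at_def)
        then have "F j \<inter> solos = {S}" using solo_unique by blast
        then show ?thesis by simp
      qed
      then show ?thesis by simp
    qed
    finally show ?thesis .
  qed
  have "2 * card solo_at = (\<Sum>j\<in>solo_at. 2)" by simp
  also have "\<dots> \<le> (\<Sum>j\<in>solo_at. card (F j \<inter> - solos))"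
  proof (rule sum_mono)
    fix j assume "j \<in> solo_at"
    then obtain S where S: "j \<in> J" "S \<in> F j" "S \<in> solos" by (auto simp: solo_at_def)
    then obtain T where T: "T \<in> F j" "T \<noteq> S" using solo_partner by blast
    obtain T' where T': "T' \<in> F j" "T' \<noteq> S" "T' \<noteq> T" using solo_third[OF S(3,1,2) T] by blast
    have "{T, T'} \<subseteq> F j \<inter> - solos" using S T T' solo_unique by blast
    then have "card {T, T'} \<le> card (F j \<inter> - solos)"
      using finite_F[OF S(1)] by (intro card_mono) auto
    then show "2 \<le> card (F j \<inter> - solos)" using T' by simp
  qed
  also have "\<dots> = (\<Sum>T\<in>?N. card (occ T \<inter> solo_at))"
    by (simp add: sum_card_double_count[OF solo_at] Diff_eq)
  finally have p: "2 * card solos \<le> (\<Sum>T\<in>?N. card (occ T \<inter> solo_at))"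
    by (simp add: solo_count)
  have "5 * card ?N + (\<Sum>T\<in>?N. card (occ T \<inter> solo_at)) = (\<Sum>T\<in>?N. 5 + card (occ T \<inter> solo_at))"
    by (simp add: sum.distrib)
  also have "\<dots> \<le> (\<Sum>T\<in>?N. 3 * card (occ T))"
  proof (rule sum_mono)
    fix T assume "T \<in> ?N"
    then show "5 + card (occ T \<inter> solo_at) \<le> 3 * card (occ T)"
      using occ_weight[of T] card_Int_Diff[OF finite_occ, of T solo_at] by linarith
  qed
  finally have N: "5 * card ?N + 2 * card solos \<le> 3 * (\<Sum>T\<in>?N. card (occ T))"
    using p by (simp add: sum_distrib_left)
  have "(\<Sum>j\<in>J. card (F j)) = (\<Sum>T\<in>balanced U. card (occ T))"
    using sum_card_double_count[of J UNIV] by (simp add: occ_J)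
  also have "\<dots> = (\<Sum>T\<in>?N. card (occ T)) + (\<Sum>T\<in>solos. card (occ T))"
    by (rule sum.subset_diff[OF sub fin])
  also have "(\<Sum>T\<in>solos. card (occ T)) = card solos" by (simp add: solos_def)
  finally have tot: "(\<Sum>j\<in>J. card (F j)) = (\<Sum>T\<in>?N. card (occ T)) + card solos" .
  have "card (balanced U) = card ?N + card solos"
    using sub fin by (metis card_Diff_subset card_mono finite_subset le_add_diff_inverse2)
  then show ?thesis using N tot by simp
qed

end

section \<open>The function with balanced columns\<close>

text \<open>A column and its complement belong to the two literals of one variable, so \<open>g\<close> enumerates the
  balanced sets that contain row \<open>0\<close>. The variables from \<open>m\<close> on pad the number of variables to \<open>n\<close>.
  They are constantly false on the rows: a positive padding literal is false at all rows and all
  neighbours considered, and a negative one is true there, so neither can help a conjunction.\<close>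

locale balanced_columns =
  fixes k m n :: nat and g :: "nat \<Rightarrow> nat set"
  assumes k: "k \<ge> 7" and g: "bij_betw g {..<m} {A \<in> balanced {..<k}. 0 \<in> A}" and m: "m \<le> n"
begin

definition row :: "nat \<Rightarrow> bool list" where
  "row r = map (\<lambda>i. i < m \<and> r \<in> g i) [0..<n]"

definition fn :: "bool list \<Rightarrow> bool" where
  "fn = restrict (\<lambda>x. x \<notin> row ` {..<k}) (cube n)"

definition col :: "lit \<Rightarrow> nat set" where
  "col l = {r. r < k \<and> lit_eval l (row r)}"

lemma length_row [simp]: "length (row r) = n"
  by (simp add: row_def)

lemma row_nth [simp]: "i < n \<Longrightarrow> row r ! i \<longleftrightarrow> i < m \<and> r \<in> g i"
  by (simp add: row_def)

lemma g_image: "g ` {..<m} = {A \<in> balanced {..<k}. 0 \<in> A}"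
  using g by (rule bij_betw_imp_surj_on)

lemma g_balanced:
  assumes "i < m"
  shows "g i \<in> balanced {..<k}" "0 \<in> g i"
proof -
  have "g i \<in> g ` {..<m}" using assms by simp
  then show "g i \<in> balanced {..<k}" "0 \<in> g i" unfolding g_image by blast+
qed

lemma g_eq_iff: "i < m \<Longrightarrow> j < m \<Longrightarrow> g i = g j \<longleftrightarrow> i = j"
  using bij_betw_imp_inj_on[OF g] by (simp add: inj_on_eq_iff)

lemma g_surj:
  assumes "A \<in> balanced {..<k}" "0 \<in> A"
  shows "\<exists>i < m. g i = A"
proof -
  have "A \<in> g ` {..<m}" unfolding g_image using assms by blast
  then show ?thesis by blast
qed

lemma g_subset: "i < m \<Longrightarrow> g i \<subseteq> {..<k}"
  using g_balanced(1)[of i] by (simp add: balanced_def)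

lemma col_Pos:
  assumes "i < m"
  shows "col (Pos i) = g i"
proof -
  have "col (Pos i) = {..<k} \<inter> g i" using assms m by (auto simp: col_def)
  then show ?thesis using g_subset[OF assms] by (simp add: Int_absorb1)
qed

lemma col_Neg: "i < m \<Longrightarrow> col (Neg i) = {..<k} - g i"
  using m by (auto simp: col_def)

lemma col_balanced:
  assumes "lit_var l < m"
  shows "col l \<in> balanced {..<k}"
proof (cases l)
  case (Pos i)
  with assms show ?thesis using g_balanced[of i] by (simp add: col_Pos)
next
  case (Neg i)
  with assms show ?thesis using g_balanced[of i] by (simp add: col_Neg balanced_Diff)
qed

lemma col_surj:
  assumes "S \<in> balanced {..<k}"
  shows "\<exists>l. lit_var l < m \<and> col l = S"
proof (cases "0 \<in> S")
  case True
  then obtain i where "i < m" "g i = S" using g_surj assms by blast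
  then show ?thesis by (intro exI[of _ "Pos i"]) (simp add: col_Pos)
next
  case False
  have sub: "S \<subseteq> {..<k}" using assms by (simp add: balanced_def)
  have "0 \<in> {..<k} - S" using False k by simp
  then obtain i where i: "i < m" "g i = {..<k} - S"
    using g_surj balanced_Diff[OF finite_lessThan assms] by blast
  then have "col (Neg i) = S" using sub by (simp add: col_Neg double_diff)
  then show ?thesis using i by (intro exI[of _ "Neg i"]) simp
qed

lemma zero_in_col: "lit_var l < m \<Longrightarrow> 0 \<in> col l \<longleftrightarrow> l = Pos (lit_var l)"
  using g_balanced(2)[of "lit_var l"] k by (cases l) (simp_all add: col_Pos col_Neg)

lemma col_compl_var:
  assumes "lit_var l < m" "lit_var l' < m" "col l = {..<k} - col l'"
  shows "lit_var l = lit_var l'"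
proof -
  have zero: "0 \<in> col l \<longleftrightarrow> 0 \<notin> col l'" using assms(3) k by auto
  have "col l' \<subseteq> {..<k}" by (auto simp: col_def)
  then have compl: "col l' = {..<k} - col l" using assms(3) by (simp add: double_diff)
  show ?thesis
  proof (cases "0 \<in> col l")
    case True
    then have eqs: "l = Pos (lit_var l)" "l' = Neg (lit_var l')"
      using zero zero_in_col assms(1,2) by (auto, cases l', auto)
    then have "g (lit_var l) = {..<k} - ({..<k} - g (lit_var l'))"
      using assms col_Pos[of "lit_var l"] col_Neg[of "lit_var l'"] by metis
    then show ?thesis using g_subset[OF assms(2)] g_eq_iff[OF assms(1,2)] by (simp add: double_diff)
  next
    case False
    then have eqs: "l = Neg (lit_var l)" "l' = Pos (lit_var l')"
      using zero zero_in_col assms(1,2) by (cases l, auto)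
    then have "g (lit_var l') = {..<k} - ({..<k} - g (lit_var l))"
      using assms compl col_Pos[of "lit_var l'"] col_Neg[of "lit_var l"] by metis
    then show ?thesis using g_subset[OF assms(1)] g_eq_iff[OF assms(2,1)] by (simp add: double_diff)
  qed
qed

lemma two_separating_columns:
  assumes "r < k" "r' < k" "r \<noteq> r'"
  shows "\<exists>i' < m. i' \<noteq> i \<and> (r \<in> g i') \<noteq> (r' \<in> g i')"
proof -
  obtain A where A: "A \<in> balanced {..<k}" "r \<in> A" "r' \<notin> A" "A \<noteq> g i" "A \<noteq> {..<k} - g i"
    using balanced_separating[of "{..<k}" r r' "g i" "{..<k} - g i"] assms k by auto
  obtain l where l: "lit_var l < m" "col l = A" using col_surj[OF A(1)] by blast
  have sep: "lit_eval l (row r) \<noteq> lit_eval l (row r')"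
    using l(2) A(2,3) assms by (auto simp: col_def)
  show ?thesis
  proof (cases l)
    case (Pos j)
    then have "j \<noteq> i" using l A by (auto simp: col_Pos)
    then show ?thesis using l sep Pos m by (intro exI[of _ j]) auto
  next
    case (Neg j)
    then have "j \<noteq> i" using l A by (auto simp: col_Neg)
    then show ?thesis using l sep Neg m by (intro exI[of _ j]) auto
  qed
qed

lemma inj_row: "inj_on row {..<k}"
proof (rule inj_onI)
  fix r r' assume r: "r \<in> {..<k}" "r' \<in> {..<k}" "row r = row r'"
  show "r = r'"
  proof (rule ccontr)
    assume "r \<noteq> r'"
    then obtain i where "i < m" "(r \<in> g i) \<noteq> (r' \<in> g i)"
      using two_separating_columns r by blast
    then have "row r ! i \<noteq> row r' ! i" using m by simp
    then show False using r by simp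
  qed
qed

lemma fn_P_class: "fn \<in> P_class k n"
proof -
  have "{x \<in> cube n. \<not> fn x} = row ` {..<k}" by (auto simp: fn_def cube_def)
  then have "card {x \<in> cube n. \<not> fn x} = k" by (simp add: card_image inj_row)
  then show ?thesis by (simp add: P_class_def fn_def)
qed

text \<open>Distinct rows differ at least in two positions, so that a single flip does not reach another
  zero.\<close>

lemma neighbour_not_row:
  assumes "i < n" "r < k"
  shows "(row r)[i := \<not> row r ! i] \<notin> row ` {..<k}"
proof
  assume "(row r)[i := \<not> row r ! i] \<in> row ` {..<k}"
  then obtain r' where r': "r' < k" "(row r)[i := \<not> row r ! i] = row r'" by auto
  have "row r' ! i \<longleftrightarrow> \<not> row r ! i"
    unfolding r'(2)[symmetric] using assms by simp
  then have "r \<noteq> r'" by auto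
  then obtain j where j: "j < m" "j \<noteq> i" "(r \<in> g j) \<noteq> (r' \<in> g j)"
    using two_separating_columns r' assms by blast
  have "row r' ! j \<longleftrightarrow> row r ! j"
    unfolding r'(2)[symmetric] using j by simp
  then show False using j m by simp
qed

lemma dnf_rank_lower_bound:
  assumes D: "is_dnf_of n fn D"
  shows "5 * card (balanced {..<k}) \<le> 3 * dnf_rank D"
proof -
  \<comment> \<open>Conjunctions with a positive padding literal are discarded: they are false at every row and
    cover no neighbour, and unlike the others they need not have empty intersection on the
    unpadded columns.\<close>
  define J where "J = {C \<in> set D. \<forall>l \<in> set C. m \<le> lit_var l \<longrightarrow> (\<exists>v. l = Neg v)}"
  define F where "F C = col ` {l \<in> set C. lit_var l < m}" for C
  have var: "lit_var l < n" if "C \<in> set D" "l \<in> set C" for C l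
    using D that by (auto simp: is_dnf_of_def)
  have empty_Inter: "\<exists>A \<in> F C. r \<notin> A" if C: "C \<in> J" and r: "r < k" for C r
  proof -
    have "row r \<in> cube n" "\<not> fn (row r)" using r by (auto simp: fn_def cube_def)
    then have "\<not> conj_eval C (row r)"
      using D C by (auto simp: is_dnf_of_def dnf_eval_def J_def)
    then obtain l where l: "l \<in> set C" "\<not> lit_eval l (row r)" by (auto simp: conj_eval_def)
    have "lit_var l < m"
    proof (rule ccontr)
      assume "\<not> lit_var l < m"
      moreover from this obtain v where "l = Neg v" using C l by (auto simp: J_def)
      ultimately show False using l var[of C l] C by (simp add: J_def)
    qed
    then show ?thesis using l by (auto simp: F_def col_def)
  qed
  interpret serving_family "{..<k}" J F
  proof
    show "finite {..<k}" "{..<k} \<noteq> {}" using k by (auto simp: lessThan_empty_iff)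
    show "finite J" by (simp add: J_def)
    show "F C \<subseteq> balanced {..<k}" for C by (auto simp: F_def col_balanced)
    show "\<exists>A \<in> F C. r \<notin> A" if "C \<in> J" "r \<in> {..<k}" for C r
      using empty_Inter that by simp
    fix S r assume S: "S \<in> balanced {..<k}" and r: "r \<in> {..<k} - S"
    obtain l0 where l0: "lit_var l0 < m" "col l0 = S" using col_surj[OF S] by blast
    define i where "i = lit_var l0"
    have i: "i < m" "i < n" using l0 m by (auto simp: i_def)
    define x where "x = (row r)[i := \<not> row r ! i]"
    have x_nth: "x ! j \<longleftrightarrow> (if j = i then \<not> row r ! i else row r ! j)" if "j < n" for j
      using that by (simp add: x_def nth_list_update)
    have "\<not> lit_eval l0 (row r)" using l0 r by (auto simp: col_def)
    then have l0_x: "lit_eval l0 x"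
      using x_nth[OF i(2)] by (cases l0) (auto simp: i_def)
    have at_i: "l = l0" if "lit_eval l x" "lit_var l = i" for l
      using that l0_x by (cases l; cases l0) (auto simp: i_def)
    have off_i: "lit_eval l x \<longleftrightarrow> lit_eval l (row r)" if "lit_var l < n" "lit_var l \<noteq> i" for l
      using that x_nth[of "lit_var l"] by (cases l) auto
    have "x \<in> cube n" "fn x"
      using neighbour_not_row[OF i(2), of r] r by (auto simp: fn_def cube_def x_def)
    then obtain C where C: "C \<in> set D" "conj_eval C x"
      using D by (auto simp: is_dnf_of_def dnf_eval_def)
    have true: "lit_eval l x" if "l \<in> set C" for l using C that by (simp add: conj_eval_def)
    have CJ: "C \<in> J"
    proof -
      have "\<exists>v. l = Neg v" if l: "l \<in> set C" "m \<le> lit_var l" for l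
      proof (cases l)
        case (Pos v)
        have "lit_var l \<noteq> i" using l i by simp
        then have "lit_eval l (row r)" using off_i[OF var[OF C(1) l(1)]] true[OF l(1)] by blast
        then show ?thesis using Pos l var[OF C(1) l(1)] by simp
      qed simp
      then show ?thesis using C by (simp add: J_def)
    qed
    have others: "r \<in> T" if T: "T \<in> F C" "T \<noteq> S" for T
    proof -
      obtain l where l: "l \<in> set C" "lit_var l < m" "T = col l" using T by (auto simp: F_def)
      then have "lit_var l \<noteq> i" using at_i[OF true] T l0 by blast
      moreover have "lit_var l < n" using l(2) m by simp
      ultimately have "lit_eval l (row r)" using off_i true[OF l(1)] by blast
      then show ?thesis using l r by (simp add: col_def)
    qed
    have "S \<in> F C" using empty_Inter[OF CJ, of r] others r by auto
    moreover have "{..<k} - S \<notin> F C"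
    proof
      assume "{..<k} - S \<in> F C"
      then obtain l where l: "l \<in> set C" "lit_var l < m" "col l = {..<k} - S"
        by (auto simp: F_def)
      then have "lit_var l = i" using col_compl_var[of l l0] l0 by (simp add: i_def)
      then have "l = l0" using at_i true l by blast
      then show False using l l0 r by auto
    qed
    ultimately show "\<exists>C \<in> J. S \<in> F C \<and> {..<k} - S \<notin> F C \<and> (\<forall>T \<in> F C. T \<noteq> S \<longrightarrow> r \<in> T)"
      using CJ others by blast
  qed
  have "(\<Sum>C\<in>J. card (F C)) \<le> (\<Sum>C\<in>set D. length C)"
  proof -
    have "card (F C) \<le> length C" for C
    proof -
      have "card (F C) \<le> card {l \<in> set C. lit_var l < m}"
        unfolding F_def by (rule card_image_le) simp
      also have "\<dots> \<le> card (set C)" by (rule card_mono) auto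
      finally show ?thesis using card_length[of C] by simp
    qed
    then have "(\<Sum>C\<in>J. card (F C)) \<le> (\<Sum>C\<in>J. length C)" by (rule sum_mono)
    also have "\<dots> \<le> (\<Sum>C\<in>set D. length C)" by (rule sum_mono2) (auto simp: J_def)
    finally show ?thesis .
  qed
  also have "(\<Sum>C\<in>set D. length C) \<le> dnf_rank D"
    unfolding dnf_rank_def by (induction D) (auto simp: sum.insert_if)
  finally show ?thesis using five_thirds by simp
qed

end

text \<open>The bound counts the proper subsets of \<open>{..<k}\<close> that contain \<open>0\<close>; it ensures that the balanced
  columns fit into the given number of variables.\<close>

lemma card_balanced_half:
  assumes "k > 0"
  shows "card {A \<in> balanced {..<k}. 0 \<in> A} \<le> 2 ^ (k - 1) - 1"
proof -
  let ?R = "{A \<in> balanced {..<k}. 0 \<in> A}"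
  have "inj_on (\<lambda>A. A - {0}) ?R" by (rule inj_onI) blast
  moreover have "(\<lambda>A. A - {0}) ` ?R \<subseteq> Pow {1..<k} - {{1..<k}}"
  proof
    fix B assume "B \<in> (\<lambda>A. A - {0}) ` ?R"
    then obtain A where A: "A \<in> balanced {..<k}" "0 \<in> A" "B = A - {0}" by auto
    then have sub: "A \<subseteq> {..<k}" "12 * card A \<le> 7 * k" by (auto simp: balanced_def)
    have "B \<noteq> {1..<k}"
    proof
      assume "B = {1..<k}"
      then have "A = insert 0 {1..<k}" using A by blast
      then have "A = {..<k}" using assms by auto
      then show False using sub assms by simp
    qed
    moreover have "B \<subseteq> {1..<k}"
    proof
      fix b assume "b \<in> B"
      then have "b < k" "b \<noteq> 0" using A sub by auto
      then show "b \<in> {1..<k}" by simp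
    qed
    ultimately show "B \<in> Pow {1..<k} - {{1..<k}}" by blast
  qed
  ultimately have "card ?R \<le> card (Pow {1..<k} - {{1..<k}})"
    by (intro card_inj_on_le) auto
  then show ?thesis by (simp add: card_Diff_subset card_Pow)
qed

theorem mainTheorem2:
  "\<exists>\<delta> :: nat \<Rightarrow> real. \<delta> \<longlonglongrightarrow> 0 \<and>
     (\<forall>\<^sub>F k in sequentially. \<exists>f \<in> P_class k (2 ^ (k - 1) - 1).
        \<forall>D. minimal_dnf (2 ^ (k - 1) - 1) f D \<longrightarrow>
          real (dnf_rank D) > 5 / 3 * 2 ^ k * (1 + \<delta> k))"
  \<comment> \<open>Chebyshev's inequality loses \<open>36 / k\<close>; one more unit makes the inequality strict.\<close>
proof (intro exI[of _ "\<lambda>k. - 37 / real k"] conjI)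
  show "(\<lambda>k. - 37 / real k) \<longlonglongrightarrow> 0"
    using tendsto_mult_right_zero[OF lim_inverse_n', of "- 37"] by simp
  have "\<exists>f \<in> P_class k (2 ^ (k - 1) - 1).
        \<forall>D. minimal_dnf (2 ^ (k - 1) - 1) f D \<longrightarrow>
          real (dnf_rank D) > 5 / 3 * 2 ^ k * (1 + - 37 / real k)" if k: "k \<ge> 7" for k
  proof -
    let ?R = "{A \<in> balanced {..<k}. 0 \<in> A}"
    have "finite ?R" using finite_balanced[of "{..<k}"] by simp
    then obtain g where g: "bij_betw g {..<card ?R} ?R"
      using ex_bij_betw_nat_finite[of ?R] by (auto simp: atLeast0LessThan)
    interpret balanced_columns k "card ?R" "2 ^ (k - 1) - 1" g
      by unfold_locales (use k g card_balanced_half[of k] in auto)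
    show ?thesis
    proof (intro bexI[of _ fn] allI impI)
      show "fn \<in> P_class k (2 ^ (k - 1) - 1)" by (rule fn_P_class)
      fix D assume "minimal_dnf (2 ^ (k - 1) - 1) fn D"
      then have "is_dnf_of (2 ^ (k - 1) - 1) fn D"
        by (simp add: minimal_dnf_def is_arg_min_def)
      then have "5 * card (balanced {..<k}) \<le> 3 * dnf_rank D" by (rule dnf_rank_lower_bound)
      then have "5 * real (card (balanced {..<k})) \<le> 3 * real (dnf_rank D)" by linarith
      moreover have "2 ^ k * (1 - 36 / real k) \<le> real (card (balanced {..<k}))"
        using card_balanced[of "{..<k}"] k by (auto simp: lessThan_empty_iff)
      moreover have "2 ^ k * (1 + - 37 / real k) < 2 ^ k * (1 - 36 / real k)"
        using k by (intro mult_strict_left_mono) (auto simp: field_simps)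
      ultimately show "real (dnf_rank D) > 5 / 3 * 2 ^ k * (1 + - 37 / real k)" by linarith
    qed
  qed
  then show "\<forall>\<^sub>F k in sequentially. \<exists>f \<in> P_class k (2 ^ (k - 1) - 1).
        \<forall>D. minimal_dnf (2 ^ (k - 1) - 1) f D \<longrightarrow>
          real (dnf_rank D) > 5 / 3 * 2 ^ k * (1 + - 37 / real k)"
    by (rule eventually_sequentiallyI)
qed

end
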